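(* For every fixed $r \ge 1$, the function $$s \mapsto \theta_4(rs)\,\theta_4\!\left(\frac{r}{s}\right) - 2\,\theta_o(rs)\,\theta_o\!\left(\frac{r}{s}\right), \qquad s>0,$$ attains its maximum at $s = 1$.
   Context: For $s>0$, $\theta_4(s) = \sum_{k\in\mathbb{Z}} (-1)^k e^{-\pi k^2 s}$ and $\theta_o(s) = \sum_{k\in\mathbb{Z}} e^{-\pi (2k+1)^2 s}$. *)

theory Defs
  imports "HOL-Analysis.Analysis"
begin

definition theta4 :: "real \<Rightarrow> real" where
  "theta4 s = (\<Sum>\<^sub>\<infinity>k::int. (-1) powi k * exp (- pi * (of_int k)^2 * s))"

definition theta_o :: "real \<Rightarrow> real" where
  "theta_o s = (\<Sum>\<^sub>\<infinity>k::int. exp (- pi * (2 * of_int k + 1)^2 * s))"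

end

theory Submission
  imports Defs
begin

text \<open>
  With \<open>\<theta>\<^sub>3(s) = \<Sum>\<^sub>k exp (- pi k\<^sup>2 s)\<close>, splitting by the parity of \<open>k\<close> gives \<open>theta4 s = 2 \<theta>\<^sub>3(4 s) - \<theta>\<^sub>3(s)\<close> and
  \<open>theta_o s = \<theta>\<^sub>3(s) - \<theta>\<^sub>3(4 s)\<close>, so that the function in question equals
  \<open>2 \<theta>\<^sub>3(4 x) \<theta>\<^sub>3(4 y) - \<theta>\<^sub>3(x) \<theta>\<^sub>3(y)\<close> at \<open>x = r s\<close>, \<open>y = r / s\<close>. By symmetry let \<open>s \<ge> 1\<close>, that is \<open>y \<le> x\<close>.

  Let \<open>\<sigma>(x) = - x \<theta>\<^sub>3'(x) / \<theta>\<^sub>3(x)\<close>. Applying \<open>s d/ds\<close> to the function gives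
  \<open>2 \<theta>\<^sub>3(4 x) \<theta>\<^sub>3(4 y) (\<sigma>(4 y) - \<sigma>(4 x)) - \<theta>\<^sub>3(x) \<theta>\<^sub>3(y) (\<sigma>(y) - \<sigma>(x))\<close>, and \<open>\<theta>\<^sub>3(4 x) \<le> \<theta>\<^sub>3(x)\<close>.
  Hence the derivative is nonpositive where both \<open>\<sigma>(x)\<close> and \<open>\<sigma>(x) - 2 \<sigma>(4 x)\<close> are decreasing, which is
  the case for \<open>pi x \<ge> 2\<close>. The estimates hold for the truncations of \<open>\<theta>\<^sub>3\<close>, uniformly in the number of
  terms, so that only finite sums are differentiated.

  If \<open>pi y < 2\<close>, then the value at \<open>s\<close> is at most \<open>theta4 y \<le> 3/4\<close>, and the value at \<open>1\<close> is larger.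
\<close>

section \<open>Numerical bounds for the exponential function\<close>

lemma exp_1_ge_2718: "2.718 \<le> exp (1::real)"
  using e_approx_32 by (simp add: abs_if split: if_splits)

lemma exp_2_bounds: "7.38 \<le> exp (2::real)" "exp (2::real) \<le> 7.4"
proof -
  have square: "exp (2::real) = (exp 1)\<^sup>2"
    using exp_double[of "1::real"] by simp
  have "2.718\<^sup>2 \<le> (exp (1::real))\<^sup>2"
    by (intro power_mono exp_1_ge_2718) auto
  then show "7.38 \<le> exp (2::real)"
    unfolding square by (simp add: power2_eq_square)
  have "(exp (1::real))\<^sup>2 \<le> 2.72\<^sup>2"
    using e_less_272 by (intro power_mono) auto
  then show "exp (2::real) \<le> 7.4"
    unfolding square by (simp add: power2_eq_square)
qed

lemma exp_minus_le_if_ge_2: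
  assumes "2 \<le> (X::real)"
  shows "exp (- X) \<le> 0.1356"
proof -
  have "7.38 \<le> exp X"
    using exp_2_bounds(1) assms by (meson exp_le_cancel_iff order_trans)
  then show ?thesis
    by (simp add: exp_minus field_simps)
qed

lemma mult_exp_minus_le_if_ge_2:
  assumes "2 \<le> (X::real)"
  shows "X * exp (- X) \<le> 0.2712"
proof -
  have "X \<le> 2 * (1 + (X - 2))"
    using assms by simp
  also have "\<dots> \<le> 2 * exp (X - 2)"
    by (intro mult_left_mono exp_ge_add_one_self) simp
  finally have "X * exp (- X) \<le> 2 * exp (X - 2) * exp (- X)"
    by (intro mult_right_mono) auto
  also have "\<dots> = 2 * exp (- 2)"
    by (simp flip: exp_add)
  also have "\<dots> \<le> 0.2712"
    using exp_minus_le_if_ge_2[of 2] by simp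
  finally show ?thesis .
qed

lemma exp_minus_6_le: "exp (- 6 :: real) \<le> 1/336"
proof -
  have "exp (- 6 :: real) = exp (- 2) ^ 3"
    by (simp flip: exp_of_nat_mult)
  also have "\<dots> \<le> 0.1356 ^ 3"
    by (intro power_mono exp_minus_le_if_ge_2) auto
  finally show ?thesis
    by (simp add: power3_eq_cube)
qed

lemma exp_minus_pi_mult_le:
  assumes "1 \<le> x"
  shows "exp (- (pi * x)) \<le> 1/20"
proof -
  have "20 \<le> 7.38 * (2.718::real)"
    by simp
  also have "\<dots> \<le> exp 2 * exp 1"
    by (intro mult_mono exp_2_bounds exp_1_ge_2718) auto
  also have "\<dots> = exp 3"
    by (simp flip: exp_add)
  also have "\<dots> \<le> exp (pi * x)"
    using mult_mono[of 3 pi 1 x] pi_gt3 assms by simp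
  finally show ?thesis
    by (simp add: exp_minus field_simps)
qed

section \<open>Truncated theta sums\<close>

text \<open>The argument \<open>X\<close> of the truncated sums stands for \<open>pi s\<close>.\<close>

definition theta_moment :: "nat \<Rightarrow> nat \<Rightarrow> real \<Rightarrow> real" where
  "theta_moment j n X = 2 * (\<Sum>k<n. (real k + 1) ^ (2 * j) * exp (- ((real k + 1)\<^sup>2 * X)))"

definition theta3_partial :: "nat \<Rightarrow> real \<Rightarrow> real" where
  "theta3_partial n X = 1 + theta_moment 0 n X"

lemma DERIV_theta_moment [derivative_intros]:
  assumes "(f has_real_derivative f') (at x within A)"
  shows "((\<lambda>x. theta_moment j n (f x)) has_real_derivative - theta_moment (Suc j) n (f x) * f') (at x within A)"
  unfolding theta_moment_def
  by (auto intro!: derivative_eq_intros assms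
      simp: sum_distrib_left sum_distrib_right power_add power2_eq_square mult_ac simp flip: sum_negf)

lemma DERIV_theta3_partial [derivative_intros]:
  assumes "(f has_real_derivative f') (at x within A)"
  shows "((\<lambda>x. theta3_partial n (f x)) has_real_derivative - theta_moment 1 n (f x) * f') (at x within A)"
  unfolding theta3_partial_def by (auto intro!: derivative_eq_intros assms)

lemma theta_moment_nonneg: "0 \<le> theta_moment j n X"
  by (simp add: theta_moment_def sum_nonneg)

lemma theta3_partial_ge_1: "1 \<le> theta3_partial n X"
  by (simp add: theta3_partial_def theta_moment_nonneg)

lemma theta_moment_le_Suc: "theta_moment j n X \<le> theta_moment (Suc j) n X"
  unfolding theta_moment_def
  by (intro mult_left_mono sum_mono mult_right_mono power_increasing) auto

lemma theta_moment_antimono: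
  assumes "X \<le> Y"
  shows "theta_moment j n Y \<le> theta_moment j n X"
  unfolding theta_moment_def
  by (intro mult_left_mono sum_mono) (auto intro: mult_left_mono assms)

lemma theta_moment_lower:
  assumes "1 \<le> n"
  shows "2 * exp (- X) \<le> theta_moment j n X"
proof -
  let ?a = "\<lambda>k. (real k + 1) ^ (2 * j) * exp (- ((real k + 1)\<^sup>2 * X))"
  have "sum ?a {0} \<le> sum ?a {..<n}"
    using assms by (intro sum_mono2) auto
  then show ?thesis
    by (simp add: theta_moment_def)
qed

lemma exp_minus_square_mult_le_geometric:
  assumes "2 \<le> X"
  shows "exp (- ((real k + 1)\<^sup>2 * X)) \<le> exp (- X) * exp (- 6) ^ k"
proof -
  have "real k \<le> real k * real k"
    by (cases k) auto
  then have "3 * real k \<le> (real k + 1)\<^sup>2 - 1"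
    by (simp add: power2_eq_square algebra_simps)
  then have "3 * real k * 2 \<le> ((real k + 1)\<^sup>2 - 1) * X"
    using assms by (intro mult_mono) auto
  then have "exp (- ((real k + 1)\<^sup>2 * X)) \<le> exp (- X + real k * - 6)"
    by (simp add: algebra_simps)
  also have "\<dots> = exp (- X) * exp (- 6) ^ k"
    unfolding exp_add exp_of_nat_mult ..
  finally show ?thesis .
qed

lemma theta_moment_term_le_geometric:
  assumes "2 \<le> X" "j \<le> 2"
  shows "(real k + 1) ^ (2 * j) * exp (- ((real k + 1)\<^sup>2 * X)) \<le> exp (- X) * (1/21) ^ k"
proof -
  have "real k + 1 \<le> 2 ^ k"
    by (induction k) auto
  then have "(real k + 1) ^ 4 \<le> (2 ^ k) ^ 4"
    by (rule power_mono) simp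
  moreover have "(real k + 1) ^ (2 * j) \<le> (real k + 1) ^ 4"
    using assms by (intro power_increasing) auto
  ultimately have "(real k + 1) ^ (2 * j) \<le> 16 ^ k"
    by (simp add: power_mult flip: power_mult[of _ k] mult.commute[of _ k])
  then have "(real k + 1) ^ (2 * j) * exp (- ((real k + 1)\<^sup>2 * X)) \<le> 16 ^ k * (exp (- X) * exp (- 6) ^ k)"
    by (intro mult_mono exp_minus_square_mult_le_geometric assms) auto
  also have "\<dots> = exp (- X) * (16 * exp (- 6)) ^ k"
    by (simp add: power_mult_distrib)
  also have "\<dots> \<le> exp (- X) * (1/21) ^ k"
    using exp_minus_6_le by (intro mult_left_mono power_mono) auto
  finally show ?thesis .
qed

lemma theta_moment_upper:
  assumes "2 \<le> X" "j \<le> 2"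
  shows "theta_moment j n X \<le> 2.1 * exp (- X)"
proof -
  have "theta_moment j n X \<le> 2 * (\<Sum>k<n. exp (- X) * (1/21) ^ k)"
    unfolding theta_moment_def
    by (intro mult_left_mono sum_mono theta_moment_term_le_geometric assms) auto
  also have "\<dots> = 2 * exp (- X) * (\<Sum>k<n. (1/21) ^ k)"
    by (simp flip: sum_distrib_left)
  also have "\<dots> \<le> 2 * exp (- X) * 1.05"
  proof (intro mult_left_mono)
    show "(\<Sum>k<n. (1/21 :: real) ^ k) \<le> 1.05"
      by (subst sum_gp_strict) (simp add: field_simps)
  qed simp
  finally show ?thesis by simp
qed

section \<open>The logarithmic slope\<close>

definition theta_log_slope :: "nat \<Rightarrow> real \<Rightarrow> real" where
  "theta_log_slope n X = X * theta_moment 1 n X / theta3_partial n X"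

definition theta_log_slope_deriv :: "nat \<Rightarrow> real \<Rightarrow> real" where
  "theta_log_slope_deriv n X =
     ((theta_moment 1 n X - X * theta_moment 2 n X) * theta3_partial n X + X * (theta_moment 1 n X)\<^sup>2)
       / (theta3_partial n X)\<^sup>2"

lemma DERIV_theta_log_slope:
  "(theta_log_slope n has_real_derivative theta_log_slope_deriv n X) (at X)"
proof -
  have "theta3_partial n X \<noteq> 0"
    using theta3_partial_ge_1[of n X] by simp
  then show ?thesis
    unfolding theta_log_slope_def[abs_def] theta_log_slope_deriv_def
    by (auto intro!: derivative_eq_intros simp: power2_eq_square algebra_simps numeral_2_eq_2)
qed

lemma theta_log_slope_deriv_numerator_le:
  assumes "1 \<le> X"
  shows "(theta_moment 1 n X - X * theta_moment 2 n X) * theta3_partial n X + X * (theta_moment 1 n X)\<^sup>2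
    \<le> theta_moment 1 n X * (1 - X + X * theta_moment 1 n X)"
proof -
  define M where "M = theta_moment 1 n X"
  have "M \<le> X * M"
    using mult_right_mono[OF assms] theta_moment_nonneg by (simp add: M_def)
  have "M - X * theta_moment 2 n X \<le> M - X * M"
    using theta_moment_le_Suc[of 1 n X] assms by (simp add: M_def numeral_2_eq_2)
  then have "(M - X * theta_moment 2 n X) * theta3_partial n X \<le> (M - X * M) * theta3_partial n X"
    using theta3_partial_ge_1[of n X] by (intro mult_right_mono) auto
  also have "\<dots> \<le> (M - X * M) * 1"
    using theta3_partial_ge_1 \<open>M \<le> X * M\<close> by (intro mult_left_mono_neg) auto
  finally show ?thesis
    unfolding M_def[symmetric] by (simp add: power2_eq_square algebra_simps)
qed

lemma theta_log_slope_deriv_le: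
  assumes "2 \<le> X" "1 \<le> n"
  shows "theta_log_slope_deriv n X \<le> - (exp (- X) / 2)"
proof -
  define q where "q = exp (- X)"
  define T where "T = theta3_partial n X"
  define M where "M = theta_moment 1 n X"
  have q: "0 < q" "q \<le> 0.1356" "X * q \<le> 0.2712"
    using exp_minus_le_if_ge_2 mult_exp_minus_le_if_ge_2 assms by (auto simp: q_def)
  have M: "2 * q \<le> M" "M \<le> 2.1 * q"
    using theta_moment_lower theta_moment_upper assms by (auto simp: M_def q_def)
  have T: "1 \<le> T" "T \<le> 1.285"
    using theta3_partial_ge_1 theta_moment_upper[of X 0 n] q assms
    by (auto simp: T_def q_def theta3_partial_def)
  have "X * M \<le> X * (2.1 * q)"
    using M assms by (intro mult_left_mono) auto
  also have "\<dots> \<le> 0.57"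
    using q by simp
  finally have "M * (1 - X + X * M) \<le> M * (- 0.43)"
    using M q assms by (intro mult_left_mono) auto
  also have "\<dots> \<le> - (0.86 * q)"
    using M by simp
  also have "\<dots> \<le> - (q / 2) * T\<^sup>2"
  proof -
    have "T\<^sup>2 \<le> 1.285\<^sup>2"
      using T by (intro power_mono) auto
    then have "q * T\<^sup>2 \<le> q * 1.72"
      using q by (intro mult_left_mono) (auto simp: power2_eq_square)
    then show ?thesis by simp
  qed
  finally have "(M - X * theta_moment 2 n X) * T + X * M\<^sup>2 \<le> - (q / 2) * T\<^sup>2"
    using theta_log_slope_deriv_numerator_le[of X n] assms by (simp add: M_def T_def)
  then show ?thesis
    using T by (simp add: theta_log_slope_deriv_def M_def T_def q_def divide_le_eq)
qed

lemma theta_log_slope_deriv_ge: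
  assumes "2 \<le> X"
  shows "- (2.1 * X * exp (- X)) \<le> theta_log_slope_deriv n X"
proof -
  define T where "T = theta3_partial n X"
  have T: "1 \<le> T"
    by (simp add: T_def theta3_partial_ge_1)
  have "X * theta_moment 2 n X * T \<le> X * (2.1 * exp (- X)) * T\<^sup>2"
    using theta_moment_upper theta_moment_nonneg T assms
    by (intro mult_mono) (auto simp: power2_eq_square)
  moreover have "0 \<le> theta_moment 1 n X * T" "0 \<le> X * (theta_moment 1 n X)\<^sup>2"
    using theta_moment_nonneg T assms by auto
  ultimately have "- (2.1 * X * exp (- X)) * T\<^sup>2
      \<le> (theta_moment 1 n X - X * theta_moment 2 n X) * T + X * (theta_moment 1 n X)\<^sup>2"
    by (simp add: algebra_simps)
  then show ?thesis
    using T by (simp add: theta_log_slope_deriv_def T_def pos_le_divide_eq)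
qed

lemma theta_log_slope_deriv_le_scaled:
  assumes "2 \<le> X" "1 \<le> n"
  shows "theta_log_slope_deriv n X \<le> 8 * theta_log_slope_deriv n (4 * X)"
proof -
  define q where "q = exp (- X)"
  have q: "0 < q" "q \<le> 0.1356" "X * q \<le> 0.2712"
    using exp_minus_le_if_ge_2 mult_exp_minus_le_if_ge_2 assms by (auto simp: q_def)
  have "q\<^sup>2 \<le> 0.1356\<^sup>2"
    using q by (intro power_mono) auto
  then have "(X * q) * q\<^sup>2 \<le> 0.2712 * 0.0184"
    using q by (intro mult_mono) (auto simp: power2_eq_square)
  then have "67.2 * (X * q ^ 3) * q \<le> 1/2 * q"
    using q by (intro mult_right_mono) (auto simp: power3_eq_cube power2_eq_square mult.assoc)
  moreover have "exp (- (4 * X)) = q ^ 3 * q"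
    by (simp add: q_def flip: exp_of_nat_mult exp_add)
  ultimately have "- (q / 2) \<le> 8 * - (2.1 * (4 * X) * exp (- (4 * X)))"
    by simp
  also have "\<dots> \<le> 8 * theta_log_slope_deriv n (4 * X)"
    using assms by (intro mult_left_mono theta_log_slope_deriv_ge) auto
  finally show ?thesis
    using theta_log_slope_deriv_le[OF assms] by (simp add: q_def)
qed

lemma theta_log_slope_antimono:
  assumes "2 \<le> Y" "Y \<le> X" "1 \<le> n"
  shows "theta_log_slope n X \<le> theta_log_slope n Y"
proof (rule DERIV_nonpos_imp_nonincreasing[OF assms(2)])
  fix x assume "Y \<le> x"
  then have "theta_log_slope_deriv n x \<le> - (exp (- x) / 2)"
    using assms by (intro theta_log_slope_deriv_le) auto
  also have "\<dots> \<le> 0" by simp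
  finally show "\<exists>D. (theta_log_slope n has_real_derivative D) (at x) \<and> D \<le> 0"
    using DERIV_theta_log_slope by blast
qed

lemma theta_log_slope_minus_scaled_antimono:
  assumes "2 \<le> Y" "Y \<le> X" "1 \<le> n"
  shows "theta_log_slope n X - 2 * theta_log_slope n (4 * X)
    \<le> theta_log_slope n Y - 2 * theta_log_slope n (4 * Y)"
proof (rule DERIV_nonpos_imp_nonincreasing[OF assms(2)])
  fix x assume "Y \<le> x"
  have "((\<lambda>x. theta_log_slope n x - 2 * theta_log_slope n (4 * x)) has_real_derivative
      theta_log_slope_deriv n x - 8 * theta_log_slope_deriv n (4 * x)) (at x)"
    by (auto intro!: derivative_eq_intros DERIV_theta_log_slope DERIV_chain2[OF DERIV_theta_log_slope])
  moreover have "theta_log_slope_deriv n x - 8 * theta_log_slope_deriv n (4 * x) \<le> 0"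
    using theta_log_slope_deriv_le_scaled \<open>Y \<le> x\<close> assms by simp
  ultimately show "\<exists>D. ((\<lambda>x. theta_log_slope n x - 2 * theta_log_slope n (4 * x)) has_real_derivative D) (at x)
      \<and> D \<le> 0"
    by blast
qed

section \<open>The truncated objective\<close>

definition objective_partial :: "nat \<Rightarrow> real \<Rightarrow> real \<Rightarrow> real" where
  "objective_partial n X Y =
     2 * theta3_partial n (4 * X) * theta3_partial n (4 * Y) - theta3_partial n X * theta3_partial n Y"

definition objective_partial_slope :: "nat \<Rightarrow> real \<Rightarrow> real \<Rightarrow> real" where
  "objective_partial_slope n X Y =
     2 * theta3_partial n (4 * X) * theta3_partial n (4 * Y) * (theta_log_slope n (4 * Y) - theta_log_slope n (4 * X))
       - theta3_partial n X * theta3_partial n Y * (theta_log_slope n Y - theta_log_slope n X)"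

lemma DERIV_theta3_partial_hyperbola:
  assumes "s \<noteq> 0"
  shows "((\<lambda>s. theta3_partial n (\<rho> * s) * theta3_partial n (\<rho> / s)) has_real_derivative
    theta3_partial n (\<rho> * s) * theta3_partial n (\<rho> / s)
      * (theta_log_slope n (\<rho> / s) - theta_log_slope n (\<rho> * s)) / s) (at s)"
proof -
  have moment: "theta_moment 1 n X * X = theta_log_slope n X * theta3_partial n X" for X
    using theta3_partial_ge_1[of n X] by (simp add: theta_log_slope_def)
  have "((\<lambda>s. theta3_partial n (\<rho> * s) * theta3_partial n (\<rho> / s)) has_real_derivative
      (theta3_partial n (\<rho> * s) * (theta_moment 1 n (\<rho> / s) * (\<rho> / s))
        - theta_moment 1 n (\<rho> * s) * (\<rho> * s) * theta3_partial n (\<rho> / s)) / s) (at s)"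
    using assms by (auto intro!: derivative_eq_intros simp: field_simps power2_eq_square)
  then show ?thesis
    unfolding moment by (simp add: algebra_simps)
qed

lemma DERIV_objective_partial_hyperbola:
  assumes "s \<noteq> 0"
  shows "((\<lambda>s. objective_partial n (\<rho> * s) (\<rho> / s)) has_real_derivative
    objective_partial_slope n (\<rho> * s) (\<rho> / s) / s) (at s)"
  using DERIV_diff[OF DERIV_cmult[OF DERIV_theta3_partial_hyperbola[OF assms, of n "4 * \<rho>"], of 2]
      DERIV_theta3_partial_hyperbola[OF assms, of n \<rho>]]
  by (simp add: objective_partial_def objective_partial_slope_def mult.assoc diff_divide_distrib)

lemma objective_partial_slope_nonpos:
  assumes "2 \<le> Y" "Y \<le> X" "1 \<le> n"
  shows "objective_partial_slope n X Y \<le> 0"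
proof -
  let ?\<theta> = "theta3_partial n" and ?\<sigma> = "theta_log_slope n"
  have "?\<theta> (4 * X) * ?\<theta> (4 * Y) \<le> ?\<theta> X * ?\<theta> Y"
    using theta_moment_antimono[of X "4 * X" 0 n] theta_moment_antimono[of Y "4 * Y" 0 n] assms
    by (intro mult_mono) (auto simp: theta3_partial_def theta_moment_nonneg)
  moreover have "?\<sigma> (4 * X) \<le> ?\<sigma> (4 * Y)"
    using assms by (intro theta_log_slope_antimono) auto
  ultimately have "?\<theta> (4 * X) * ?\<theta> (4 * Y) * (2 * (?\<sigma> (4 * Y) - ?\<sigma> (4 * X)))
      \<le> ?\<theta> X * ?\<theta> Y * (2 * (?\<sigma> (4 * Y) - ?\<sigma> (4 * X)))"
    by (intro mult_right_mono) auto
  also have "\<dots> \<le> ?\<theta> X * ?\<theta> Y * (?\<sigma> Y - ?\<sigma> X)"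
  proof (intro mult_left_mono)
    show "2 * (?\<sigma> (4 * Y) - ?\<sigma> (4 * X)) \<le> ?\<sigma> Y - ?\<sigma> X"
      using theta_log_slope_minus_scaled_antimono[OF assms] by simp
    show "0 \<le> ?\<theta> X * ?\<theta> Y"
      by (simp add: theta3_partial_def theta_moment_nonneg)
  qed
  finally show ?thesis
    by (simp add: objective_partial_slope_def algebra_simps)
qed

lemma objective_partial_le_diag:
  assumes "1 \<le> s" "2 \<le> \<rho> / s" "1 \<le> n"
  shows "objective_partial n (\<rho> * s) (\<rho> / s) \<le> objective_partial n \<rho> \<rho>"
proof -
  have "objective_partial n (\<rho> * s) (\<rho> / s) \<le> objective_partial n (\<rho> * 1) (\<rho> / 1)"
  proof (rule DERIV_nonpos_imp_nonincreasing[OF assms(1)])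
    fix x assume x: "1 \<le> x" "x \<le> s"
    have \<rho>: "0 < \<rho>"
      using assms by (simp add: pos_le_divide_eq)
    then have "\<rho> / s \<le> \<rho> / x" "\<rho> / x \<le> \<rho>" "\<rho> \<le> \<rho> * x"
      using x by (auto simp: field_simps)
    then have "objective_partial_slope n (\<rho> * x) (\<rho> / x) \<le> 0"
      using assms by (intro objective_partial_slope_nonpos) linarith+
    then have "objective_partial_slope n (\<rho> * x) (\<rho> / x) / x \<le> 0"
      using x by (simp add: divide_nonpos_pos)
    then show "\<exists>D. ((\<lambda>s. objective_partial n (\<rho> * s) (\<rho> / s)) has_real_derivative D) (at x) \<and> D \<le> 0"
      using DERIV_objective_partial_hyperbola[of x n \<rho>] x by force
  qed
  then show ?thesis by simp
qed

section \<open>Theta functions as infinite sums\<close>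

lemma has_sum_int:
  fixes f :: "int \<Rightarrow> 'a :: topological_comm_monoid_add"
  assumes pos: "((\<lambda>k. f (int (Suc k))) has_sum P) UNIV"
    and neg: "((\<lambda>k. f (- int (Suc k))) has_sum N) UNIV"
  shows "(f has_sum (f 0 + (P + N))) UNIV"
proof -
  have "(f has_sum P) (range (\<lambda>k. int (Suc k)))"
    using pos by (subst has_sum_reindex) (auto simp: o_def inj_on_def)
  moreover have "(f has_sum N) (range (\<lambda>k. - int (Suc k)))"
    using neg by (subst has_sum_reindex) (auto simp: o_def inj_on_def)
  ultimately have "(f has_sum (P + N)) (range (\<lambda>k. int (Suc k)) \<union> range (\<lambda>k. - int (Suc k)))"
    by (rule has_sum_Un_disjoint) auto
  then have "(f has_sum (f 0 + (P + N))) (insert 0 (range (\<lambda>k. int (Suc k)) \<union> range (\<lambda>k. - int (Suc k))))"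
    by (intro has_sum_insert) auto
  moreover have "k \<in> insert 0 (range (\<lambda>k. int (Suc k)) \<union> range (\<lambda>k. - int (Suc k)))" for k
    by (cases k rule: int_cases3) (auto simp: image_iff gr0_conv_Suc)
  then have "insert 0 (range (\<lambda>k. int (Suc k)) \<union> range (\<lambda>k. - int (Suc k))) = UNIV"
    by blast
  ultimately show ?thesis by simp
qed

lemma infsum_int_even_odd:
  fixes f :: "int \<Rightarrow> 'a :: banach"
  assumes "f summable_on UNIV"
  shows "infsum f UNIV = (\<Sum>\<^sub>\<infinity>k. f (2 * k)) + (\<Sum>\<^sub>\<infinity>k. f (2 * k + 1))"
proof -
  have "k \<in> range (\<lambda>k. 2 * k) \<union> range (\<lambda>k. 2 * k + 1)" for k :: int
    by (cases "even k") (auto elim: evenE oddE)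
  then have "infsum f UNIV = infsum f (range (\<lambda>k. 2 * k) \<union> range (\<lambda>k. 2 * k + 1))"
    by (intro arg_cong[of _ _ "infsum f"]) blast
  also have "\<dots> = infsum f (range (\<lambda>k. 2 * k)) + infsum f (range (\<lambda>k. 2 * k + 1))"
  proof (rule infsum_Un_disjoint)
    show "f summable_on range (\<lambda>k. 2 * k)" "f summable_on range (\<lambda>k. 2 * k + 1)"
      using assms by (auto intro: summable_on_subset_banach)
    show "range (\<lambda>k. 2 * k) \<inter> range (\<lambda>k. 2 * k + 1) = ({} :: int set)"
      by auto presburger
  qed
  also have "\<dots> = (\<Sum>\<^sub>\<infinity>k. f (2 * k)) + (\<Sum>\<^sub>\<infinity>k. f (2 * k + 1))"
    by (subst (1 2) infsum_reindex) (auto simp: o_def inj_on_def)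
  finally show ?thesis .
qed

definition theta3 :: "real \<Rightarrow> real" where
  "theta3 s = (\<Sum>\<^sub>\<infinity>k::int. exp (- pi * (of_int k)\<^sup>2 * s))"

lemma summable_gaussian:
  assumes "0 < X"
  shows "summable (\<lambda>k. exp (- ((real k + 1)\<^sup>2 * X)))"
proof (rule summable_comparison_test')
  show "summable (\<lambda>k. exp (- X) ^ k)"
    using assms by (simp add: summable_geometric)
  fix k
  have "real k \<le> (real k + 1)\<^sup>2"
    by (simp add: power2_eq_square algebra_simps)
  then have "exp (- ((real k + 1)\<^sup>2 * X)) \<le> exp (real k * - X)"
    using assms by simp
  then show "norm (exp (- ((real k + 1)\<^sup>2 * X))) \<le> exp (- X) ^ k"
    unfolding exp_of_nat_mult by simp
qed

lemma has_sum_gaussian_int: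
  assumes "0 < X"
  shows "((\<lambda>k::int. exp (- ((of_int k)\<^sup>2 * X))) has_sum
      (1 + 2 * (\<Sum>k. exp (- ((real k + 1)\<^sup>2 * X))))) UNIV"
    (is "(_ has_sum (1 + 2 * ?S)) _")
proof -
  have "((\<lambda>k. exp (- ((real k + 1)\<^sup>2 * X))) has_sum ?S) UNIV"
    using summable_gaussian[OF assms] by (intro norm_summable_imp_has_sum) (auto intro: summable_sums)
  moreover have "(- 1 - real k)\<^sup>2 = (real k + 1)\<^sup>2" for k
    by (simp add: power2_eq_square algebra_simps)
  ultimately show ?thesis
    using has_sum_int[of "\<lambda>k. exp (- ((of_int k)\<^sup>2 * X))" ?S ?S] by (simp add: add.commute)
qed

lemma summable_on_theta3:
  assumes "0 < s"
  shows "(\<lambda>k::int. exp (- pi * (of_int k)\<^sup>2 * s)) summable_on UNIV"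
  using has_sum_gaussian_int[of "pi * s"] assms by (auto simp: summable_on_def mult_ac)

lemma theta3_partial_tendsto:
  assumes "0 < s"
  shows "(\<lambda>n. theta3_partial n (pi * s)) \<longlonglongrightarrow> theta3 s"
proof -
  have "0 < pi * s"
    using assms by simp
  from has_sum_gaussian_int[OF this]
  have "theta3 s = 1 + 2 * (\<Sum>k. exp (- ((real k + 1)\<^sup>2 * (pi * s))))"
    unfolding theta3_def by (intro infsumI) (simp add: mult_ac)
  then show ?thesis
    unfolding theta3_partial_def theta_moment_def
    using summable_LIMSEQ[OF summable_gaussian[OF \<open>0 < pi * s\<close>]] by (auto intro!: tendsto_intros)
qed

lemma theta3_ge_1:
  assumes "0 < s"
  shows "1 \<le> theta3 s"
  using theta3_partial_ge_1 by (intro LIMSEQ_le_const[OF theta3_partial_tendsto[OF assms]]) auto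

lemma theta3_upper:
  assumes "0 < s" "2 \<le> pi * s"
  shows "theta3 s \<le> 1 + 2.1 * exp (- (pi * s))"
  using theta_moment_upper[OF assms(2), of 0]
  by (intro LIMSEQ_le_const2[OF theta3_partial_tendsto[OF assms(1)]]) (auto simp: theta3_partial_def)

lemma theta_o_eq_theta3:
  assumes "0 < s"
  shows "theta_o s = theta3 s - theta3 (4 * s)"
  using infsum_int_even_odd[OF summable_on_theta3[OF assms]]
  by (simp add: theta3_def theta_o_def power_mult_distrib mult_ac)

lemma theta4_eq_theta3:
  assumes "0 < s"
  shows "theta4 s = 2 * theta3 (4 * s) - theta3 s"
proof -
  let ?f = "\<lambda>k::int. (-1) powi k * exp (- pi * (of_int k)\<^sup>2 * s)"
  have "(\<lambda>k. norm (?f k)) summable_on UNIV"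
    using summable_on_theta3[OF assms] by (simp add: abs_mult power_int_abs[symmetric])
  then have "theta4 s = (\<Sum>\<^sub>\<infinity>k. ?f (2 * k)) + (\<Sum>\<^sub>\<infinity>k. ?f (2 * k + 1))"
    unfolding theta4_def by (rule infsum_int_even_odd[of ?f, OF abs_summable_summable])
  also have "(\<lambda>k. ?f (2 * k)) = (\<lambda>k. exp (- pi * (of_int k)\<^sup>2 * (4 * s)))"
    by (simp add: fun_eq_iff power_mult_distrib)
  also have "(\<lambda>k. ?f (2 * k + 1)) = (\<lambda>k. - exp (- pi * (2 * of_int k + 1)\<^sup>2 * s))"
    by (simp add: fun_eq_iff power_int_minus_left)
  also have "(\<Sum>\<^sub>\<infinity>k::int. exp (- pi * (of_int k)\<^sup>2 * (4 * s)))
      + (\<Sum>\<^sub>\<infinity>k::int. - exp (- pi * (2 * of_int k + 1)\<^sup>2 * s))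
      = theta3 (4 * s) - theta_o s"
    by (simp only: infsum_uminus theta3_def theta_o_def diff_conv_add_uminus)
  finally show ?thesis
    using theta_o_eq_theta3[OF assms] by simp
qed

lemma theta_o_nonneg: "0 \<le> theta_o s"
  by (simp add: theta_o_def infsum_nonneg)

section \<open>Upper bounds for theta4\<close>

lemma theta3_partial_alternating:
  "2 * theta3_partial n (4 * X) - theta3_partial (2 * n) X
    = 1 - 2 * (\<Sum>k<n. exp (- X) ^ (2 * k + 1)\<^sup>2 - exp (- X) ^ (2 * k + 2)\<^sup>2)"
proof -
  have power_eq: "exp (- X) ^ m = exp (- (real m * X))" for m
    by (simp flip: exp_of_nat_mult)
  have "theta3_partial n (4 * X) = 1 + 2 * (\<Sum>k<n. exp (- X) ^ (2 * k + 2)\<^sup>2)"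
    unfolding power_eq by (simp add: theta3_partial_def theta_moment_def power2_eq_square algebra_simps)
  moreover have "theta3_partial (2 * n) X
      = 1 + 2 * (\<Sum>k<n. exp (- X) ^ (2 * k + 1)\<^sup>2 + exp (- X) ^ (2 * k + 2)\<^sup>2)"
    unfolding power_eq
    by (induction n) (simp_all add: theta3_partial_def theta_moment_def add.commute)
  ultimately show ?thesis
    by (simp add: sum.distrib sum_subtractf)
qed

lemma theta4_le_if_partial_le:
  assumes "0 < s" and q: "q = exp (- (pi * s))"
    and bound: "\<And>n. 1 \<le> n \<Longrightarrow> B n \<le> (\<Sum>k<n. q ^ (2 * k + 1)\<^sup>2 - q ^ (2 * k + 2)\<^sup>2)"
    and "B \<longlonglongrightarrow> b"
  shows "theta4 s \<le> 1 - 2 * b"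
proof (rule LIMSEQ_le)
  have "(\<lambda>n. theta3_partial (2 * n) (pi * s)) \<longlonglongrightarrow> theta3 s"
    using LIMSEQ_subseq_LIMSEQ[OF theta3_partial_tendsto[OF \<open>0 < s\<close>], of "\<lambda>n. 2 * n"]
    by (simp add: o_def strict_mono_def)
  moreover have "(\<lambda>n. theta3_partial n (4 * (pi * s))) \<longlonglongrightarrow> theta3 (4 * s)"
    using theta3_partial_tendsto[of "4 * s"] \<open>0 < s\<close> by (simp add: mult_ac)
  ultimately show "(\<lambda>n. 2 * theta3_partial n (4 * (pi * s)) - theta3_partial (2 * n) (pi * s)) \<longlonglongrightarrow> theta4 s"
    unfolding theta4_eq_theta3[OF \<open>0 < s\<close>] by (intro tendsto_intros)
  show "(\<lambda>n. 1 - 2 * B n) \<longlonglongrightarrow> 1 - 2 * b"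
    by (intro tendsto_intros assms)
  show "\<exists>N. \<forall>n\<ge>N. 2 * theta3_partial n (4 * (pi * s)) - theta3_partial (2 * n) (pi * s) \<le> 1 - 2 * B n"
    unfolding theta3_partial_alternating q[symmetric] using bound by auto
qed

lemma power_odd_square_diff_le:
  fixes q :: real
  assumes "0 \<le> q" "q < 1"
  shows "q ^ (2 * k + 1)\<^sup>2 - q ^ (2 * k + 3)\<^sup>2 \<le> 3 * (q ^ (2 * k + 1)\<^sup>2 - q ^ (2 * k + 2)\<^sup>2)"
proof -
  define m where "m = 4 * k + 3"
  have squares: "(2 * k + 2)\<^sup>2 = (2 * k + 1)\<^sup>2 + m" "(2 * k + 3)\<^sup>2 = (2 * k + 1)\<^sup>2 + (2 * m + 2)"
    by (auto simp: m_def power2_eq_square algebra_simps)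
  have "q ^ (3 * m) \<le> q ^ (2 * m + 2)"
    using assms by (intro power_decreasing) (auto simp: m_def)
  then have "1 - q ^ (2 * m + 2) \<le> 1 - (q ^ m) ^ 3"
    by (simp add: mult.commute flip: power_mult)
  also have "\<dots> = (1 - q ^ m) * (1 + q ^ m + (q ^ m)\<^sup>2)"
    by (simp add: power2_eq_square power3_eq_cube algebra_simps)
  also have "\<dots> \<le> (1 - q ^ m) * 3"
  proof (intro mult_left_mono)
    show "1 + q ^ m + (q ^ m)\<^sup>2 \<le> 3"
      using power_le_one[of q m] power_le_one[of "q ^ m" 2] assms by simp
  qed (use assms in \<open>simp add: power_le_one\<close>)
  finally have "q ^ (2 * k + 1)\<^sup>2 * (1 - q ^ (2 * m + 2)) \<le> q ^ (2 * k + 1)\<^sup>2 * ((1 - q ^ m) * 3)"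
    using assms by (intro mult_left_mono) auto
  then show ?thesis
    unfolding squares by (simp add: power_add algebra_simps)
qed

lemma theta4_le_linear:
  assumes "0 < s"
  shows "theta4 s \<le> 1 - 2/3 * exp (- (pi * s))"
proof -
  define q where "q = exp (- (pi * s))"
  have q: "0 \<le> q" "q < 1"
    using assms by (auto simp: q_def)
  have "q - q ^ (2 * n + 1)\<^sup>2 \<le> 3 * (\<Sum>k<n. q ^ (2 * k + 1)\<^sup>2 - q ^ (2 * k + 2)\<^sup>2)" for n
  proof -
    have "q - q ^ (2 * n + 1)\<^sup>2 = (\<Sum>k<n. q ^ (2 * k + 1)\<^sup>2 - q ^ (2 * Suc k + 1)\<^sup>2)"
      by (subst sum_lessThan_telescope') simp
    also have "\<dots> \<le> (\<Sum>k<n. 3 * (q ^ (2 * k + 1)\<^sup>2 - q ^ (2 * k + 2)\<^sup>2))"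
      using power_odd_square_diff_le[OF q] by (intro sum_mono) (simp add: numeral_3_eq_3)
    finally show ?thesis
      by (simp add: sum_distrib_left)
  qed
  then have "(q - q ^ (2 * n + 1)\<^sup>2) / 3 \<le> (\<Sum>k<n. q ^ (2 * k + 1)\<^sup>2 - q ^ (2 * k + 2)\<^sup>2)" for n
    by (simp add: mult.commute divide_le_eq)
  moreover have "(\<lambda>n. (q - q ^ (2 * n + 1)\<^sup>2) / 3) \<longlonglongrightarrow> (q - 0) / 3"
  proof (intro tendsto_intros)
    have "strict_mono (\<lambda>n. (2 * n + 1)\<^sup>2 :: nat)"
      by (rule strict_monoI) (simp add: power_strict_mono)
    from LIMSEQ_subseq_LIMSEQ[OF LIMSEQ_realpow_zero[OF q] this]
    show "(\<lambda>n. q ^ (2 * n + 1)\<^sup>2) \<longlonglongrightarrow> 0" by (simp add: o_def)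
  qed simp
  ultimately have "theta4 s \<le> 1 - 2 * ((q - 0) / 3)"
    by (rule theta4_le_if_partial_le[OF assms q_def])
  then show ?thesis
    by (simp add: q_def)
qed

lemma theta4_le_quartic:
  assumes "0 < s"
  shows "theta4 s \<le> 1 - 2 * (exp (- (pi * s)) - exp (- (pi * s)) ^ 4)"
proof (rule theta4_le_if_partial_le[OF assms refl _ tendsto_const])
  fix n :: nat assume "1 \<le> n"
  let ?a = "\<lambda>k. exp (- (pi * s)) ^ (2 * k + 1)\<^sup>2 - exp (- (pi * s)) ^ (2 * k + 2)\<^sup>2"
  have "sum ?a {0} \<le> sum ?a {..<n}"
    using \<open>1 \<le> n\<close> assms by (intro sum_mono2) (auto intro!: power_decreasing power_mono)
  then show "exp (- (pi * s)) - exp (- (pi * s)) ^ 4 \<le> sum ?a {..<n}"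
    by (simp flip: numeral_2_eq_2)
qed

lemma theta4_le_three_quarters:
  assumes "0 < s" "pi * s \<le> 2"
  shows "theta4 s \<le> 3/4"
proof (cases "2/5 \<le> exp (- (pi * s))")
  case True
  then show ?thesis
    using theta4_le_linear[OF assms(1)] by simp
next
  case False
  define q where "q = exp (- (pi * s))"
  have "exp (- 2) \<le> q"
    using assms by (simp add: q_def)
  moreover have "0.135 \<le> exp (- 2 :: real)"
    using exp_2_bounds(2) by (simp add: exp_minus field_simps)
  ultimately have q: "0.135 \<le> q" by simp
  have "q ^ 3 * q \<le> (2/5) ^ 3 * q"
    using False by (intro mult_right_mono power_mono) (auto simp: q_def)
  then have "q ^ 4 \<le> 0.064 * q"
    by (simp add: power_numeral_reduce)
  then show ?thesis
    using theta4_le_quartic[OF assms(1)] q by (simp add: q_def)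
qed

section \<open>Maximality on the diagonal\<close>

definition objective :: "real \<Rightarrow> real \<Rightarrow> real" where
  "objective x y = theta4 x * theta4 y - 2 * theta_o x * theta_o y"

lemma objective_eq_theta3:
  assumes "0 < x" "0 < y"
  shows "objective x y = 2 * theta3 (4 * x) * theta3 (4 * y) - theta3 x * theta3 y"
  using assms by (simp add: objective_def theta4_eq_theta3 theta_o_eq_theta3 algebra_simps)

lemma objective_commute: "objective x y = objective y x"
  by (simp add: objective_def)

lemma objective_partial_tendsto:
  assumes "0 < x" "0 < y"
  shows "(\<lambda>n. objective_partial n (pi * x) (pi * y)) \<longlonglongrightarrow> objective x y"
proof -
  have "(\<lambda>n. theta3_partial n (4 * (pi * z))) \<longlonglongrightarrow> theta3 (4 * z)" if "0 < z" for z
    using theta3_partial_tendsto[of "4 * z"] that by (simp add: mult.left_commute)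
  then show ?thesis
    unfolding objective_partial_def objective_eq_theta3[OF assms]
    using assms by (intro tendsto_intros theta3_partial_tendsto)
qed

lemma objective_le_diag_if_pi_div_ge_2:
  assumes "0 < r" "1 \<le> s" "2 \<le> pi * (r / s)"
  shows "objective (r * s) (r / s) \<le> objective r r"
proof (rule LIMSEQ_le)
  show "(\<lambda>n. objective_partial n (pi * (r * s)) (pi * (r / s))) \<longlonglongrightarrow> objective (r * s) (r / s)"
    "(\<lambda>n. objective_partial n (pi * r) (pi * r)) \<longlonglongrightarrow> objective r r"
    using assms by (intro objective_partial_tendsto; simp)+
  show "\<exists>N. \<forall>n\<ge>N. objective_partial n (pi * (r * s)) (pi * (r / s)) \<le> objective_partial n (pi * r) (pi * r)"
    using objective_partial_le_diag[of s "pi * r"] assms by (auto simp: mult.assoc)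
qed

lemma theta3_le_if_ge_1:
  assumes "1 \<le> s"
  shows "theta3 s \<le> 1.105"
  using theta3_upper[of s] exp_minus_pi_mult_le[OF assms] mult_mono[of 2 pi 1 s] pi_gt3 assms by simp

lemma objective_diag_ge_three_quarters:
  assumes "1 \<le> r"
  shows "3/4 \<le> objective r r"
proof -
  have "theta3 r * theta3 r \<le> 1.105 * 1.105"
    using theta3_le_if_ge_1[OF assms] theta3_ge_1[of r] assms by (intro mult_mono) auto
  moreover have "1 * 1 \<le> theta3 (4 * r) * theta3 (4 * r)"
    using theta3_ge_1[of "4 * r"] assms by (intro mult_mono) auto
  ultimately show ?thesis
    using objective_eq_theta3[of r r] assms by simp
qed

lemma objective_le_three_quarters:
  assumes "1 \<le> x" "0 < y" "pi * y \<le> 2"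
  shows "objective x y \<le> 3/4"
proof -
  have "0 \<le> theta4 x"
    using theta4_eq_theta3[of x] theta3_ge_1[of "4 * x"] theta3_le_if_ge_1[of x] assms by simp
  then have "theta4 x * theta4 y \<le> theta4 x * (3/4)"
    using theta4_le_three_quarters assms by (intro mult_left_mono) auto
  moreover have "theta4 x \<le> 1"
    using theta4_le_linear[of x] exp_ge_zero[of "- (pi * x)"] assms by linarith
  moreover have "0 \<le> theta_o x * theta_o y"
    by (simp add: theta_o_nonneg)
  ultimately show ?thesis
    by (simp add: objective_def)
qed

lemma objective_le_diag:
  assumes "1 \<le> r" "1 \<le> s"
  shows "objective (r * s) (r / s) \<le> objective r r"
proof (cases "2 \<le> pi * (r / s)")
  case True
  then show ?thesis
    using assms by (intro objective_le_diag_if_pi_div_ge_2) auto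
next
  case False
  have "objective (r * s) (r / s) \<le> 3/4"
    using False assms mult_mono[of 1 r 1 s] by (intro objective_le_three_quarters) auto
  also have "\<dots> \<le> objective r r"
    by (rule objective_diag_ge_three_quarters[OF assms(1)])
  finally show ?thesis .
qed

theorem theorem6:
  fixes r :: real
  assumes "r \<ge> 1"
  shows "\<forall>s>0. theta4 (r * s) * theta4 (r / s) - 2 * theta_o (r * s) * theta_o (r / s)
           \<le> theta4 (r * 1) * theta4 (r / 1) - 2 * theta_o (r * 1) * theta_o (r / 1)"
proof (intro allI impI)
  fix s :: real assume "s > 0"
  have "objective (r * s) (r / s) \<le> objective r r"
  proof (cases "1 \<le> s")
    case True
    then show ?thesis
      using assms by (intro objective_le_diag)
  next
    case False
    then have "objective (r * (1 / s)) (r / (1 / s)) \<le> objective r r"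
      using \<open>s > 0\<close> assms by (intro objective_le_diag) auto
    then show ?thesis
      by (simp add: objective_commute)
  qed
  then show "theta4 (r * s) * theta4 (r / s) - 2 * theta_o (r * s) * theta_o (r / s)
           \<le> theta4 (r * 1) * theta4 (r / 1) - 2 * theta_o (r * 1) * theta_o (r / 1)"
    by (simp add: objective_def)
qed

end
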